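(* Let $k$ be a real number and let $p,m$ be integers with $1\le m\le p$. Then $$\alpha_{pm}(k)=\sum_{j=m}^{p}{p \brack j}{j\brace m}(k-1)^{p-j},$$ $$\beta_{pm}(k)=(-1)^{p-m}\sum_{j=m}^{p}{p \brack j}{j\brace m}(k-1)^{j-m}.$$
   Context: $D=\frac{d}{dx}$, acting on smooth functions on $(0,\infty)$; $x^kD$ is the operator $h\mapsto x^kh'$. For each integer $p\ge1$ the numbers $\alpha_{pm}(k)$ and $\beta_{pm}(k)$ ($1\le m\le p$) are the coefficients (constants) in the operator expansions $$(x^kD)^p=x^{p(k-1)}\sum_{m=1}^p\alpha_{pm}(k)\,x^mD^m,\qquad x^{kp}D^p=\sum_{m=1}^p\beta_{pm}(k)\,x^{(p-m)(k-1)}(x^kD)^m.$$ ${p\brack j}$ is the signless Stirling number of the first kind (number of permutations of a $p$-set with exactly $j$ cycles) and ${j\brace m}$ is the Stirling number of the second kind (number of partitions of a $j$-set into exactly $m$ parts). Convention: $0^0=1$. *)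

theory Defs
  imports "HOL-Analysis.Analysis" "HOL-Combinatorics.Stirling"
begin

(* h is only examined on the open half-line: at a point x > 0 the iterated deriv depends only
   on the values of h near x, so whatever h does on (-infinity, 0] is irrelevant. *)
definition smooth_pos :: "(real \<Rightarrow> real) \<Rightarrow> bool" where
  "smooth_pos h \<longleftrightarrow> (\<forall>n. \<forall>x>0. (deriv ^^ n) h differentiable at x)"

definition xkD :: "real \<Rightarrow> (real \<Rightarrow> real) \<Rightarrow> real \<Rightarrow> real" where
  "xkD k h = (\<lambda>x. x powr k * deriv h x)"

definition is_alpha_expansion :: "real \<Rightarrow> nat \<Rightarrow> (nat \<Rightarrow> real) \<Rightarrow> bool" where
  "is_alpha_expansion k p a \<longleftrightarrow>
     (\<forall>h. smooth_pos h \<longrightarrow> (\<forall>x>0.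
        (xkD k ^^ p) h x =
          x powr (real p * (k - 1)) * (\<Sum>m=1..p. a m * (x ^ m * (deriv ^^ m) h x))))"

definition is_beta_expansion :: "real \<Rightarrow> nat \<Rightarrow> (nat \<Rightarrow> real) \<Rightarrow> bool" where
  "is_beta_expansion k p b \<longleftrightarrow>
     (\<forall>h. smooth_pos h \<longrightarrow> (\<forall>x>0.
        x powr (k * real p) * (deriv ^^ p) h x =
          (\<Sum>m=1..p. b m * (x powr (real (p - m) * (k - 1)) * (xkD k ^^ m) h x))))"

(* The expansions constrain the coefficients only for 1 <= m <= p; they are set to 0 for all
   other m so that the description can single out one function of m. *)
definition alpha :: "real \<Rightarrow> nat \<Rightarrow> nat \<Rightarrow> real" where
  "alpha k p = (THE a. is_alpha_expansion k p a \<and> (\<forall>m. m \<notin> {1..p} \<longrightarrow> a m = 0))"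

definition beta :: "real \<Rightarrow> nat \<Rightarrow> nat \<Rightarrow> real" where
  "beta k p = (THE b. is_beta_expansion k p b \<and> (\<forall>m. m \<notin> {1..p} \<longrightarrow> b m = 0))"

end

(* For arbitrary real b and d,
     (x^d D)^p = sum_m G(p,m) x^(p(d-1) + m(1-b)) (x^b D)^m,
   because differentiating the right-hand side shows that G must satisfy
     G(p+1,m+1) = (p u + (m+1) v) G(p,m+1) + G(p,m)   with u = d-1 and v = 1-b,
   and sum_j [p,j] {j,m} u^(p-j) v^(j-m) solves this recurrence. Taking (b,d) = (0,k) gives
   alpha, and (b,d) = (k,0) gives beta. The coefficients are unique because the functions
   (x-1)^n, evaluated at x = 1, lead to a triangular linear system. *)

theory Submission
  imports Defs
begin

section \<open>Two-parameter Stirling numbers and their recurrence\<close>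

text \<open>These are the connection coefficients from the products t(t+u)...(t+(p-1)u) to the
  products t(t-v)...(t-(m-1)v). Summing over all j \<le> p keeps the range independent of m; for j <
  m the truncated exponent j - m is harmless because \<open>Stirling j m = 0\<close>.\<close>

definition gen_stirling :: "real \<Rightarrow> real \<Rightarrow> nat \<Rightarrow> nat \<Rightarrow> real" where
  "gen_stirling u v p m =
     (\<Sum>j\<le>p. real (stirling p j) * real (Stirling j m) * u ^ (p - j) * v ^ (j - m))"

lemma gen_stirling_0_0 [simp]: "gen_stirling u v 0 0 = 1"
  by (simp add: gen_stirling_def)

lemma gen_stirling_0_right [simp]: "0 < p \<Longrightarrow> gen_stirling u v p 0 = 0"
  unfolding gen_stirling_def
  by (intro sum.neutral ballI) (metis Stirling.simps(3) mult_eq_0_iff not0_implies_Suc of_nat_0 stirling_0)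

lemma gen_stirling_less [simp]: "p < m \<Longrightarrow> gen_stirling u v p m = 0"
  unfolding gen_stirling_def by (intro sum.neutral) auto

lemma gen_stirling_atLeastAtMost:
  "gen_stirling u v p m =
     (\<Sum>j=m..p. real (stirling p j) * real (Stirling j m) * u ^ (p - j) * v ^ (j - m))"
  unfolding gen_stirling_def by (rule sum.mono_neutral_right) (auto simp: not_le)

lemma gen_stirling_same [simp]: "gen_stirling u v p p = 1"
  by (simp add: gen_stirling_atLeastAtMost)

text \<open>Expand [p+1,j+1] = p [p,j+1] + [p,j] first. The part with [p,j+1] is a shifted copy of
  the sum for (p, m+1); in the part with [p,j], the recurrence of {j+1,m+1} produces the two
  remaining terms.\<close>

lemma gen_stirling_Suc_Suc:
  "gen_stirling u v (Suc p) (Suc m) =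
     (real p * u + real (Suc m) * v) * gen_stirling u v p (Suc m) + gen_stirling u v p m"
proof -
  let ?t = "\<lambda>j. real (stirling p j) * real (Stirling j (Suc m)) * v ^ (j - Suc m)"
  have first: "(\<Sum>j\<le>p. ?t (Suc j) * u ^ (p - j)) = u * gen_stirling u v p (Suc m)"
  proof -
    have "(\<Sum>j\<le>p. ?t (Suc j) * u ^ (p - j)) = (\<Sum>j\<le>p. u * (?t (Suc j) * u ^ (p - Suc j)))"
    proof (rule sum.cong[OF refl])
      fix j assume "j \<in> {..p}"
      show "?t (Suc j) * u ^ (p - j) = u * (?t (Suc j) * u ^ (p - Suc j))"
      \<comment> \<open>At j = p no factor u can be split off, since both exponents are 0; there
        \<open>stirling p (Suc p) = 0\<close>.\<close>
      proof (cases "j = p")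
        case False
        then have "p - j = Suc (p - Suc j)" using \<open>j \<in> {..p}\<close> by auto
        then show ?thesis by simp
      qed simp
    qed
    also have "\<dots> = (\<Sum>j\<le>Suc p. u * (?t j * u ^ (p - j)))"
      by (simp add: sum.atMost_Suc_shift del: sum.atMost_Suc Stirling.simps(4))
    also have "\<dots> = u * gen_stirling u v p (Suc m)"
      by (simp add: gen_stirling_def sum_distrib_left mult_ac)
    finally show ?thesis .
  qed
  \<comment> \<open>Splitting off v is genuine only for j > m; otherwise
    \<open>Stirling j (Suc m) = 0\<close>.\<close>
  have second: "real (Stirling j (Suc m)) * v ^ (j - m) = v * (real (Stirling j (Suc m)) * v ^ (j - Suc m))"
    for j
  proof (cases "j \<le> m")
    case False
    then have "j - m = Suc (j - Suc m)" by auto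
    then show ?thesis by simp
  qed simp
  have "gen_stirling u v (Suc p) (Suc m) =
      (\<Sum>j\<le>p. real (stirling (Suc p) (Suc j)) * real (Stirling (Suc j) (Suc m)) * u ^ (p - j) * v ^ (j - m))"
    unfolding gen_stirling_def
    by (subst sum.atMost_Suc_shift) (simp del: Stirling.simps(4) stirling.simps(4))
  also have "\<dots> = (\<Sum>j\<le>p. real p * (?t (Suc j) * u ^ (p - j))
      + real (stirling p j) * u ^ (p - j) *
          (real (Suc m) * (real (Stirling j (Suc m)) * v ^ (j - m)) + real (Stirling j m) * v ^ (j - m)))"
    by (intro sum.cong) (auto simp: algebra_simps)
  also have "\<dots> = real p * (u * gen_stirling u v p (Suc m))
      + real (Suc m) * v * gen_stirling u v p (Suc m) + gen_stirling u v p m"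
    unfolding second sum.distrib sum_distrib_left[symmetric] first
    by (simp add: gen_stirling_def sum_distrib_left sum.distrib[symmetric] algebra_simps)
  finally show ?thesis by (simp add: algebra_simps)
qed

text \<open>The recurrence in the form that differentiating an expansion produces: each
  \<open>t m\<close> turns into a multiple of itself plus \<open>t (Suc m)\<close>.\<close>

lemma gen_stirling_Suc_sum:
  "(\<Sum>m\<le>Suc p. gen_stirling u v (Suc p) m * t m) =
     (\<Sum>m\<le>p. gen_stirling u v p m * ((real p * u + real m * v) * t m + t (Suc m)))"
proof -
  let ?c = "\<lambda>m. (real p * u + real m * v) * gen_stirling u v p m * t m"
  have "(\<Sum>m\<le>Suc p. gen_stirling u v (Suc p) m * t m) =
      (\<Sum>m\<le>p. ?c (Suc m)) + (\<Sum>m\<le>p. gen_stirling u v p m * t (Suc m))"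
    by (simp add: sum.atMost_Suc_shift gen_stirling_Suc_Suc sum.distrib algebra_simps del: sum.atMost_Suc)
  \<comment> \<open>The added term \<open>?c 0\<close> is 0: for p = 0 through the factors p and m,
    for p > 0 because \<open>gen_stirling u v p 0 = 0\<close>.\<close>
  also have "(\<Sum>m\<le>p. ?c (Suc m)) = (\<Sum>m\<le>Suc p. ?c m)"
    by (cases "p = 0") (simp_all add: sum.atMost_Suc_shift del: sum.atMost_Suc)
  also have "\<dots> = (\<Sum>m\<le>p. ?c m)" by simp
  finally show ?thesis by (simp add: sum.distrib algebra_simps)
qed

section \<open>Powers of one operator expanded in powers of another\<close>

text \<open>Smoothness measured by iterates of \<open>xkD b\<close> instead of \<open>deriv\<close>,
  so that one expansion lemma serves both directions of change between \<open>deriv\<close> and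
  \<open>xkD k\<close>.\<close>

definition xkD_smooth :: "real \<Rightarrow> (real \<Rightarrow> real) \<Rightarrow> bool" where
  "xkD_smooth b h \<longleftrightarrow> (\<forall>n. \<forall>x>0. (xkD b ^^ n) h differentiable at x)"

text \<open>By D = x^(-b) (x^b D), differentiating an iterate leads to the next iterate.\<close>

lemma DERIV_xkD:
  assumes "xkD_smooth b h" and "x > 0"
  shows "((xkD b ^^ m) h has_real_derivative x powr (- b) * (xkD b ^^ Suc m) h x) (at x)"
proof -
  have "x powr (- b) * (xkD b ^^ Suc m) h x = deriv ((xkD b ^^ m) h) x"
    using assms by (simp add: xkD_def powr_minus)
  then show ?thesis
    using assms by (simp add: xkD_smooth_def DERIV_deriv_iff_real_differentiable del: funpow.simps)
qed

lemma DERIV_xkD_sum: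
  assumes "xkD_smooth b h" and "x > 0"
  shows "((\<lambda>x. \<Sum>m\<le>p. c m * (x powr e m * (xkD b ^^ m) h x)) has_real_derivative
     (\<Sum>m\<le>p. c m * (e m * x powr (e m - 1) * (xkD b ^^ m) h x
                      + x powr (e m - b) * (xkD b ^^ Suc m) h x))) (at x)"
  using \<open>x > 0\<close>
  by (auto intro!: derivative_eq_intros DERIV_xkD[OF assms] sum.cong
      simp: powr_diff powr_minus divide_simps simp del: funpow.simps)

lemma xkD_power_expansion:
  assumes "xkD_smooth b h" and "x > 0"
  shows "(xkD d ^^ p) h x =
     (\<Sum>m\<le>p. gen_stirling (d - 1) (1 - b) p m *
        (x powr (real p * (d - 1) + real m * (1 - b)) * (xkD b ^^ m) h x))"
  using \<open>x > 0\<close>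
proof (induction p arbitrary: x)
  case 0
  then show ?case by simp
next
  case (Suc p)
  let ?e = "\<lambda>m. real p * (d - 1) + real m * (1 - b)"
  let ?G = "gen_stirling (d - 1) (1 - b) p"
  let ?t = "\<lambda>m. x powr (real (Suc p) * (d - 1) + real m * (1 - b)) * (xkD b ^^ m) h x"
  \<comment> \<open>The induction hypothesis holds on the whole open half-line, so the derivative of
    the sum carries over to \<open>(xkD d ^^ p) h\<close>, which also yields differentiability of
    this iterate.\<close>
  have "((xkD d ^^ p) h has_real_derivative
     (\<Sum>m\<le>p. ?G m * (?e m * x powr (?e m - 1) * (xkD b ^^ m) h x
                      + x powr (?e m - b) * (xkD b ^^ Suc m) h x))) (at x)"
    by (rule has_field_derivative_transform_within_open
          [OF DERIV_xkD_sum[OF assms(1) \<open>x > 0\<close>], where S = "{0<..}"])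
       (use Suc in \<open>auto simp del: funpow.simps\<close>)
  then have "(xkD d ^^ Suc p) h x = x powr d *
     (\<Sum>m\<le>p. ?G m * (?e m * x powr (?e m - 1) * (xkD b ^^ m) h x
                      + x powr (?e m - b) * (xkD b ^^ Suc m) h x))"
    by (simp add: xkD_def DERIV_imp_deriv)
  \<comment> \<open>Multiplying by \<open>x powr d\<close> turns the exponents
    \<open>?e m - 1\<close> and \<open>?e m - b\<close> into those of \<open>?t m\<close> and
    \<open>?t (Suc m)\<close>. The factor \<open>?e m\<close> is the coefficient p u + m v of the
    recurrence.\<close>
  also have "\<dots> = (\<Sum>m\<le>p. ?G m * (?e m * ?t m + ?t (Suc m)))"
    unfolding sum_distrib_left
  proof (rule sum.cong[OF refl])
    fix m
    have 1: "x powr (real (Suc p) * (d - 1) + real m * (1 - b)) = x powr d * x powr (?e m - 1)"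
      unfolding powr_add[symmetric] by (simp add: algebra_simps)
    have 2: "x powr (real (Suc p) * (d - 1) + real (Suc m) * (1 - b)) = x powr d * x powr (?e m - b)"
      unfolding powr_add[symmetric] by (simp add: algebra_simps)
    show "x powr d * (?G m * (?e m * x powr (?e m - 1) * (xkD b ^^ m) h x
                      + x powr (?e m - b) * (xkD b ^^ Suc m) h x))
       = ?G m * (?e m * ?t m + ?t (Suc m))"
      unfolding 1 2 by (simp only: algebra_simps)
  qed
  also have "\<dots> = (\<Sum>m\<le>Suc p. gen_stirling (d - 1) (1 - b) (Suc p) m * ?t m)"
    by (rule gen_stirling_Suc_sum[symmetric])
  finally show ?case .
qed

text \<open>The expansion writes each iterate of \<open>xkD d\<close> on the half-line as a finite
  sum of powers of x times differentiable iterates of \<open>xkD b\<close>.\<close>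

lemma xkD_smooth_change_exponent:
  assumes "xkD_smooth b h"
  shows "xkD_smooth d h"
  unfolding xkD_smooth_def
proof (intro allI impI)
  fix n and x :: real
  assume "x > 0"
  have "\<exists>D. ((xkD d ^^ n) h has_real_derivative D) (at x)"
    by (rule exI, rule has_field_derivative_transform_within_open
          [OF DERIV_xkD_sum[OF assms \<open>x > 0\<close>], where S = "{0<..}"])
       (use \<open>x > 0\<close> xkD_power_expansion[OF assms] in \<open>auto simp del: funpow.simps\<close>)
  then show "(xkD d ^^ n) h differentiable at x"
    by (simp add: real_differentiable_def)
qed

section \<open>Ordinary derivatives as exponent zero, and existence of both expansions\<close>

text \<open>Because \<open>0 powr 0 = 0\<close>, the operators \<open>xkD 0\<close> and
  \<open>deriv\<close> can differ at 0. Agreement on the open half-line survives differentiation,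
  which is local.\<close>

lemma xkD_0_power: "x > 0 \<Longrightarrow> (xkD 0 ^^ n) h x = (deriv ^^ n) h x"
proof (induction n arbitrary: x)
  case (Suc n)
  have "\<forall>\<^sub>F y in nhds x. y > 0"
    using Suc.prems by (simp add: eventually_nhds_in_open[of "{0<..}", simplified])
  then have "deriv ((xkD 0 ^^ n) h) x = deriv ((deriv ^^ n) h) x"
    by (intro deriv_cong_ev) (auto elim!: eventually_mono simp: Suc.IH)
  then show ?case using Suc.prems by (simp add: xkD_def[of 0 "(xkD 0 ^^ n) h"])
qed simp

lemma smooth_pos_imp_xkD_smooth:
  assumes "smooth_pos h"
  shows "xkD_smooth b h"
proof (rule xkD_smooth_change_exponent)
  show "xkD_smooth 0 h"
    unfolding xkD_smooth_def
  proof (intro allI impI)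
    fix n and x :: real
    assume "x > 0"
    then obtain D where "((deriv ^^ n) h has_real_derivative D) (at x)"
      using assms by (auto simp: smooth_pos_def real_differentiable_def)
    then have "((xkD 0 ^^ n) h has_real_derivative D) (at x)"
      by (rule has_field_derivative_transform_within_open[where S = "{0<..}"])
         (use \<open>x > 0\<close> in \<open>auto simp: xkD_0_power\<close>)
    then show "(xkD 0 ^^ n) h differentiable at x"
      by (auto simp: real_differentiable_def)
  qed
qed

lemma sum_atMost_eq_from_1:
  fixes f :: "nat \<Rightarrow> real"
  shows "f 0 = 0 \<Longrightarrow> (\<Sum>m\<le>p. f m) = (\<Sum>m=1..p. f m)"
  by (rule sum.mono_neutral_right) (auto simp: Suc_le_eq)

lemma is_alpha_expansion_gen_stirling:
  assumes "p \<ge> 1"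
  shows "is_alpha_expansion k p (gen_stirling (k - 1) 1 p)"
  unfolding is_alpha_expansion_def
proof (intro allI impI)
  fix h and x :: real
  assume "smooth_pos h" "x > 0"
  have "(xkD k ^^ p) h x =
     (\<Sum>m\<le>p. gen_stirling (k - 1) 1 p m * (x powr (real p * (k - 1) + real m) * (deriv ^^ m) h x))"
    using xkD_power_expansion[OF smooth_pos_imp_xkD_smooth[OF \<open>smooth_pos h\<close>, of 0] \<open>x > 0\<close>, of p k] \<open>x > 0\<close>
    by (simp add: xkD_0_power)
  also have "\<dots> = x powr (real p * (k - 1)) *
      (\<Sum>m\<le>p. gen_stirling (k - 1) 1 p m * (x ^ m * (deriv ^^ m) h x))"
    using \<open>x > 0\<close> by (simp add: sum_distrib_left powr_add powr_realpow mult_ac)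
  also have "(\<Sum>m\<le>p. gen_stirling (k - 1) 1 p m * (x ^ m * (deriv ^^ m) h x)) =
      (\<Sum>m=1..p. gen_stirling (k - 1) 1 p m * (x ^ m * (deriv ^^ m) h x))"
    by (rule sum_atMost_eq_from_1) (use assms in simp)
  finally show "(xkD k ^^ p) h x = x powr (real p * (k - 1)) *
      (\<Sum>m=1..p. gen_stirling (k - 1) 1 p m * (x ^ m * (deriv ^^ m) h x))" .
qed

text \<open>With b = k and d = 0 the expansion has exponents m(1-k) - p; multiplying by x^(kp) gives
  (p-m)(k-1).\<close>

lemma is_beta_expansion_gen_stirling:
  assumes "p \<ge> 1"
  shows "is_beta_expansion k p (gen_stirling (- 1) (1 - k) p)"
  unfolding is_beta_expansion_def
proof (intro allI impI)
  fix h and x :: real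
  assume "smooth_pos h" "x > 0"
  let ?G = "gen_stirling (- 1) (1 - k) p"
  have "x powr (k * real p) * (deriv ^^ p) h x =
     (\<Sum>m\<le>p. x powr (k * real p) * (?G m * (x powr (real m * (1 - k) - real p) * (xkD k ^^ m) h x)))"
    using xkD_power_expansion[OF smooth_pos_imp_xkD_smooth[OF \<open>smooth_pos h\<close>, of k] \<open>x > 0\<close>, of p 0] \<open>x > 0\<close>
    by (simp add: xkD_0_power sum_distrib_left)
  also have "\<dots> = (\<Sum>m\<le>p. ?G m * (x powr (real (p - m) * (k - 1)) * (xkD k ^^ m) h x))"
  proof (rule sum.cong[OF refl])
    fix m assume "m \<in> {..p}"
    then have "x powr (real (p - m) * (k - 1)) = x powr (k * real p) * x powr (real m * (1 - k) - real p)"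
      unfolding powr_add[symmetric] by (simp add: of_nat_diff algebra_simps)
    then show "x powr (k * real p) * (?G m * (x powr (real m * (1 - k) - real p) * (xkD k ^^ m) h x)) =
        ?G m * (x powr (real (p - m) * (k - 1)) * (xkD k ^^ m) h x)"
      by simp
  qed
  also have "\<dots> = (\<Sum>m=1..p. ?G m * (x powr (real (p - m) * (k - 1)) * (xkD k ^^ m) h x))"
    by (rule sum_atMost_eq_from_1) (use assms in simp)
  finally show "x powr (k * real p) * (deriv ^^ p) h x =
      (\<Sum>m=1..p. ?G m * (x powr (real (p - m) * (k - 1)) * (xkD k ^^ m) h x))" .
qed

section \<open>Test functions and uniqueness of the coefficients\<close>

text \<open>The product is a falling factorial of n. For m > n it contains the factor n - n = 0,
  which makes the truncated exponent n - m harmless.\<close>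

lemma deriv_power_shift:
  fixes a :: real
  shows "(deriv ^^ m) (\<lambda>x. (x - a) ^ n) = (\<lambda>x. (\<Prod>i<m. real n - real i) * (x - a) ^ (n - m))"
proof (induction m)
  case (Suc m)
  have "deriv (\<lambda>x. (\<Prod>i<m. real n - real i) * (x - a) ^ (n - m)) x =
      (\<Prod>i<Suc m. real n - real i) * (x - a) ^ (n - Suc m)" for x
  proof -
    have "((\<lambda>x. (\<Prod>i<m. real n - real i) * (x - a) ^ (n - m)) has_real_derivative
        (\<Prod>i<m. real n - real i) * (real (n - m) * (x - a) ^ (n - Suc m))) (at x)"
      by (auto intro!: derivative_eq_intros)
    then have "deriv (\<lambda>x. (\<Prod>i<m. real n - real i) * (x - a) ^ (n - m)) x =
        (\<Prod>i<m. real n - real i) * (real (n - m) * (x - a) ^ (n - Suc m))"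
      by (rule DERIV_imp_deriv)
    moreover have "(\<Prod>i<m. real n - real i) = 0" if "n < m"
      using that by (intro prod_zero) auto
    ultimately show ?thesis
      by (cases "n < m") (auto simp: of_nat_diff)
  qed
  then show ?case by (simp add: Suc)
qed simp

lemma smooth_pos_power_shift: "smooth_pos (\<lambda>x. (x - a) ^ n)"
  unfolding smooth_pos_def deriv_power_shift by (auto intro!: derivative_intros)

lemma deriv_power_shift_at:
  fixes a :: real
  shows "(deriv ^^ m) (\<lambda>x. (x - a) ^ n) a = (if m = n then fact n else 0)"
proof -
  have "(\<Prod>i<n. real n - real i) = fact n"
    by (simp add: fact_prod_rev of_nat_prod of_nat_diff lessThan_atLeast0)
  moreover have "(\<Prod>i<m. real n - real i) = 0" if "n < m"
    using that by (intro prod_zero) auto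
  ultimately show ?thesis
    unfolding deriv_power_shift by (cases n m rule: linorder_cases) auto
qed

text \<open>These are the entries of the linear system for the beta coefficients: they vanish for n
  > m and equal n! for n = m.\<close>

lemma xkD_power_shift_at_1:
  assumes "m \<ge> 1"
  shows "(xkD k ^^ m) (\<lambda>x. (x - 1) ^ n) 1 = gen_stirling (k - 1) 1 m n * fact n"
proof -
  have "(xkD k ^^ m) (\<lambda>x. (x - 1) ^ n) 1 =
      (\<Sum>l=1..m. gen_stirling (k - 1) 1 m l * (deriv ^^ l) (\<lambda>x. (x - 1) ^ n) 1)"
    using is_alpha_expansion_gen_stirling[OF assms, unfolded is_alpha_expansion_def, rule_format,
        OF smooth_pos_power_shift zero_less_one, of k 1 n]
    by simp
  also have "\<dots> = (\<Sum>l=1..m. if l = n then gen_stirling (k - 1) 1 m n * fact n else 0)"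
    by (intro sum.cong) (auto simp: deriv_power_shift_at)
  \<comment> \<open>If n lies outside {1..m}, the sum is empty of nonzero terms, and
    \<open>gen_stirling (k - 1) 1 m n\<close> is 0 as well.\<close>
  also have "\<dots> = gen_stirling (k - 1) 1 m n * fact n"
    using assms by (cases "n = 0") (auto simp: not_le)
  finally show ?thesis .
qed

text \<open>At x = 1 all powers of x are 1, and (x-1)^m retains only its m-th derivative, so the
  system for alpha is even diagonal.\<close>

lemma alpha_expansion_unique:
  assumes "is_alpha_expansion k p a" and "is_alpha_expansion k p a'" and "m \<in> {1..p}"
  shows "a m = a' m"
proof -
  have "(xkD k ^^ p) (\<lambda>x. (x - 1) ^ m) 1 = c m * fact m" if "is_alpha_expansion k p c" for c
  proof -
    have "(xkD k ^^ p) (\<lambda>x. (x - 1) ^ m) 1 = (\<Sum>l=1..p. c l * (deriv ^^ l) (\<lambda>x. (x - 1) ^ m) 1)"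
      using that[unfolded is_alpha_expansion_def, rule_format, OF smooth_pos_power_shift zero_less_one, of 1 m]
      by simp
    then show ?thesis
      using assms(3) by (auto simp: deriv_power_shift_at if_distrib cong: if_cong)
  qed
  from this[OF assms(1)] this[OF assms(2)] show ?thesis by simp
qed

text \<open>Testing with (x-1)^m involves only the coefficients with index l \<ge> m. Back
  substitution runs from m = p downwards, hence the induction on p - m.\<close>

lemma beta_expansion_unique:
  assumes "is_beta_expansion k p b" and "is_beta_expansion k p b'" and "m \<in> {1..p}"
  shows "b m = b' m"
  using assms(3)
proof (induction m rule: measure_induct_rule[where f = "\<lambda>m. p - m"])
  case (less m)
  have expand: "(deriv ^^ p) (\<lambda>x. (x - 1) ^ m) 1 =
      (\<Sum>l\<in>{1..p}. c l * (gen_stirling (k - 1) 1 l m * fact m))" if "is_beta_expansion k p c" for c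
  proof -
    have "(deriv ^^ p) (\<lambda>x. (x - 1) ^ m) 1 = (\<Sum>l=1..p. c l * (xkD k ^^ l) (\<lambda>x. (x - 1) ^ m) 1)"
      using that[unfolded is_beta_expansion_def, rule_format, OF smooth_pos_power_shift zero_less_one, of 1 m]
      by simp
    then show ?thesis by (simp add: xkD_power_shift_at_1)
  qed
  have "0 = (\<Sum>l\<in>{1..p}. (b l - b' l) * (gen_stirling (k - 1) 1 l m * fact m))"
    using expand[OF assms(1)] expand[OF assms(2)] by (simp add: left_diff_distrib sum_subtractf)
  \<comment> \<open>Terms with l < m vanish by triangularity, those with l > m by the induction
    hypothesis. The remaining term has the nonzero factor m!.\<close>
  also have "\<dots> = (\<Sum>l\<in>{m}. (b l - b' l) * (gen_stirling (k - 1) 1 l m * fact m))"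
  proof (rule sum.mono_neutral_right)
    show "\<forall>l\<in>{1..p} - {m}. (b l - b' l) * (gen_stirling (k - 1) 1 l m * fact m) = 0"
    proof
      fix l assume l: "l \<in> {1..p} - {m}"
      show "(b l - b' l) * (gen_stirling (k - 1) 1 l m * fact m) = 0"
      proof (cases "l < m")
        case False
        then have "b l = b' l" using l less.prems by (intro less.IH) auto
        then show ?thesis by simp
      qed simp
    qed
  qed (use less.prems in auto)
  finally show ?case by simp
qed

section \<open>Identification of the coefficients and closed forms\<close>

text \<open>For p \<ge> 1 the two-parameter numbers vanish outside {1..p}, so they meet the
  normalisation in the description as well as the expansion.\<close>

lemma alpha_eq_gen_stirling:
  assumes "p \<ge> 1"
  shows "alpha k p = gen_stirling (k - 1) 1 p"
  unfolding alpha_def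
proof (rule the_equality)
  show "is_alpha_expansion k p (gen_stirling (k - 1) 1 p) \<and>
      (\<forall>m. m \<notin> {1..p} \<longrightarrow> gen_stirling (k - 1) 1 p m = 0)"
    using is_alpha_expansion_gen_stirling[OF assms] assms by (auto simp: not_le Suc_le_eq)
next
  fix a assume a: "is_alpha_expansion k p a \<and> (\<forall>m. m \<notin> {1..p} \<longrightarrow> a m = 0)"
  show "a = gen_stirling (k - 1) 1 p"
  proof
    fix m show "a m = gen_stirling (k - 1) 1 p m"
      using a alpha_expansion_unique[OF _ is_alpha_expansion_gen_stirling[OF assms]] assms
      by (cases "m \<in> {1..p}") (auto simp: not_le Suc_le_eq)
  qed
qed

lemma beta_eq_gen_stirling:
  assumes "p \<ge> 1"
  shows "beta k p = gen_stirling (- 1) (1 - k) p"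
  unfolding beta_def
proof (rule the_equality)
  show "is_beta_expansion k p (gen_stirling (- 1) (1 - k) p) \<and>
      (\<forall>m. m \<notin> {1..p} \<longrightarrow> gen_stirling (- 1) (1 - k) p m = 0)"
    using is_beta_expansion_gen_stirling[OF assms] assms by (auto simp: not_le Suc_le_eq)
next
  fix b assume b: "is_beta_expansion k p b \<and> (\<forall>m. m \<notin> {1..p} \<longrightarrow> b m = 0)"
  show "b = gen_stirling (- 1) (1 - k) p"
  proof
    fix m show "b m = gen_stirling (- 1) (1 - k) p m"
      using b beta_expansion_unique[OF _ is_beta_expansion_gen_stirling[OF assms]] assms
      by (cases "m \<in> {1..p}") (auto simp: not_le Suc_le_eq)
  qed
qed

theorem theorem6:
  fixes k :: real and p m :: nat
  assumes "1 \<le> m" and "m \<le> p"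
  shows "alpha k p m =
           (\<Sum>j=m..p. real (stirling p j) * real (Stirling j m) * (k - 1) ^ (p - j)) \<and>
         beta k p m =
           (- 1) ^ (p - m) *
           (\<Sum>j=m..p. real (stirling p j) * real (Stirling j m) * (k - 1) ^ (j - m))"
proof
  have p: "p \<ge> 1" using assms by simp
  show "alpha k p m = (\<Sum>j=m..p. real (stirling p j) * real (Stirling j m) * (k - 1) ^ (p - j))"
    by (simp add: alpha_eq_gen_stirling[OF p] gen_stirling_atLeastAtMost)
  \<comment> \<open>The signs from 1 - k = -(k - 1) and from u = -1 combine to (-1)^(p-m),
    independent of j.\<close>
  have sign: "(- 1) ^ (p - j) * (1 - k) ^ (j - m) = (- 1) ^ (p - m) * (k - 1) ^ (j - m)"
    if "j \<in> {m..p}" for j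
  proof -
    have "p - m = (p - j) + (j - m)" using that by auto
    moreover have "(1 - k) ^ (j - m) = (- 1) ^ (j - m) * (k - 1) ^ (j - m)"
      by (simp flip: power_mult_distrib)
    ultimately show ?thesis by (simp add: power_add)
  qed
  show "beta k p m = (- 1) ^ (p - m) *
      (\<Sum>j=m..p. real (stirling p j) * real (Stirling j m) * (k - 1) ^ (j - m))"
    unfolding beta_eq_gen_stirling[OF p] gen_stirling_atLeastAtMost sum_distrib_left
    by (intro sum.cong refl) (simp add: sign mult.assoc mult.left_commute)
qed

end
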